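(* Let $z\in\mathbb{R}^{dn}$ be a configuration at which the algebraic contact constraint $c$ is differentiable and at which the normal non-mortar matrix $D_N(z)\in\mathbb{R}^{m_1\times m_1}$ is invertible, and let $T(z)\in\mathbb{R}^{dn\times dn}$ be the decoupling transformation defined in the context. Then, in the transformed coordinates $$\bar u = T(z)^{-1}u ,\qquad u\in\mathbb{R}^{dn},$$ the linearised contact constraints $$D(z)\,u^1_C + M(z)\,u^2_C \;\ge\; -c(z)$$ take the form $$\bar u^1_{C,0}\;\le\; c(z).$$ That is, $u$ satisfies the first system of (componentwise) inequalities if and only if $\bar u=T(z)^{-1}u$ satisfies the second. Here $\bar u^1_{C,0}\in\mathbb{R}^{m_1}$ is the vector that contains the first entry of each block of $d$ degrees of freedom of $\bar u$ on the non-mortar contact boundary $\gamma_h^1$.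
   Context: Setting. $\Omega=\Omega^1\cup\Omega^2$ are the reference configurations of two disjoint bodies in $\mathbb{R}^d$, $d\in\{2,3\}$, with contact boundary parts $\Gamma_C^1$ (non-mortar) and $\Gamma_C^2$ (mortar). $\mathcal T_h$ is a grid of $\Omega$ with $n$ vertices, and $\psi_p$ is the first-order nodal basis function of vertex $p$. A coefficient vector $z\in\mathbb{R}^{dn}$ (a block vector of $n$ blocks of size $d$) is identified with the first-order finite element deformation $\varphi_h=\sum_p z_p\psi_p$. Let $m_1$ and $m_2$ be the numbers of grid vertices on $\Gamma_C^1$ and $\Gamma_C^2$. Vectors are ordered as $u=(u_C^1,u_C^2,u^I)$ with $u_C^1\in\mathbb{R}^{dm_1}$ and $u_C^2\in\mathbb{R}^{dm_2}$ the degrees of freedom on $\Gamma_C^1$ and $\Gamma_C^2$, and $u^I$ all the others; correspondingly $z=(z_C^1,z_C^2,z^I)$. Algebraic contact constraint. For a deformation $z$, let $\gamma_h^i$ be the grid of the deformed contact boundary (the restriction of $\mathcal T_h$ to $\Gamma_C^i$, deformed by $\varphi_h$), $i=1,2$. Let $\Phi:\gamma_h^1\to\gamma_h^2$, $\Phi(s)=\operatorname{arg\,min}_{r\in\gamma_h^2}\|s-r\|$, be the closest-point projection. Let $\mathbf n_h=\sum_{p}\psi_p\mathbf n_p$ (sum over the vertices $p$ of $\gamma_h^2$) be the smoothed normal field, where $\mathbf n_p$ is the normalised sum of the face normals at $p$ of the faces of $\gamma_h^2$ adjacent to $p$. Let $g_h(s)=\mathbf n_h(\Phi(s))\cdot(s-\Phi(s))$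 be the discrete gap function, and let $\{\theta_q\}_{q=1}^{m_1}$ be the dual mortar basis of the Lagrange multiplier space on $\gamma_h^1$ (one basis function per vertex of $\gamma_h^1$). The algebraic contact constraint is $c:\mathbb{R}^{dn}\to\mathbb{R}^{m_1}$, $$c_q(z)=\int_{\gamma_h^1} g_h(s)\,\theta_q(s)\,ds,\qquad 1\le q\le m_1,$$ with non-penetration expressed as $c(z)\ge 0$. Since $c$ depends only on the deformation of the contact boundaries, its Jacobian has the form $\nabla c(z)=\begin{pmatrix}D(z)&M(z)&0\end{pmatrix}$ with $$D(z)=\frac{\partial c(z)}{\partial z_C^1}\in\mathbb{R}^{m_1\times dm_1}\ \text{(non-mortar matrix)},\qquad M(z)=\frac{\partial c(z)}{\partial z_C^2}\in\mathbb{R}^{m_1\times dm_2}\ \text{(mortar matrix)},$$ regarded as block matrices with $1\times d$ blocks $D_{pq}$, $M_{pq}$. Transformation. Let $O(z)\in\mathbb{R}^{dm_1\times dm_1}$ be the block-diagonal matrix whose $d\times d$ diagonal block $O_{pp}(z)$ is the Householder transformation mapping the first Euclidean basis vector $e_1$ onto the direction of the normal $\mathbf n_h$ at the projected vertex $\Phi(p)\in\gamma_h^2$. Define $D_N(z)\in\mathbb{R}^{m_1\times m_1}$ and $D_T(z)\in\mathbb{R}^{m_1\times(d-1)m_1}$ by splitting each $1\times d$ block of $D(z)O(z)$ into its first entry and its remaining $d-1$ entries: $$(D(z)O(z))_{pq}=\begin{pmatrix}(D_N)_{pq}&(D_T)_{pq}\end{pmatrix}.$$ The decoupling transformation is $$T(z)=\begin{pmatrix}O(z)K(z)&-O(z)L(z)&0\\0&\mathrm{Id}&0\\0&0&\mathrm{Id}\end{pmatrix},$$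 with $K(z)$ and $L(z)$ given by their $d\times d$ blocks $$K_{pq}=\begin{pmatrix}-(D_N^{-1})_{pq}&-(D_N^{-1}D_T)_{pq}\\0&\delta_p^q\,\mathrm{Id}^{(d-1)\times(d-1)}\end{pmatrix},\qquad L_{pq}=\begin{pmatrix}(D_N^{-1}M)_{pq}\\0^{(d-1)\times d}\end{pmatrix},$$ where $\delta_p^q$ is the Kronecker delta. *)

theory Defs
  imports "HOL-Analysis.Analysis" "HOL-Library.Disjoint_Sets"
begin

text \<open>
  The coordinates of \<open>\<real>\<^sup>d\<close> are indexed by the type \<open>'k option\<close>: \<open>None\<close> is the first coordinate and
  \<open>Some j\<close> are the remaining \<open>d - 1\<close> ones, so \<open>d = CARD('k option)\<close>.  The parameter domains of
  faces (of dimension \<open>d - 1\<close>) live in \<open>real ^ 'k\<close>.  The \<open>n\<close> grid vertices are the elements of the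
  type \<open>'v\<close>, the \<open>m\<^sub>1\<close> (\<open>m\<^sub>2\<close>) vertices on the non-mortar (mortar) contact boundary are the elements
  of \<open>'c1\<close> (\<open>'c2\<close>).  A coefficient vector in \<open>\<real>\<^sup>d\<^sup>n\<close> has type \<open>real ^ ('v \<times> 'k option)\<close>; its block
  at the vertex \<open>p\<close> consists of the entries \<open>(p, i)\<close>.
\<close>

section \<open>First-order finite elements\<close>

text \<open>
  A partition \<open>P\<close> of the coordinate directions stands for the product of the unit simplices in the
  coordinates of the blocks: one block gives the simplex, singleton blocks give the cube, and
  \<open>{{i, j}, {k}}\<close> gives the triangular prism.  \<open>Pyramid a\<close> is the square pyramid in
  \<open>\<real>\<^sup>3\<close> with its apex on the \<open>a\<close>-axis.
\<close>

datatype 'a ref_shape = Product "'a set set" | Pyramid 'a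

fun valid_shape :: "'a::finite ref_shape \<Rightarrow> bool" where
  "valid_shape (Product P) \<longleftrightarrow> partition_on UNIV P"
| "valid_shape (Pyramid a) \<longleftrightarrow> CARD('a) = 3"

fun ref_corners :: "'a::finite ref_shape \<Rightarrow> (real ^ 'a) set" where
  "ref_corners (Product P) =
     {c. (\<forall>i. c $ i \<in> {0, 1}) \<and> (\<forall>B\<in>P. (\<Sum>i\<in>B. c $ i) \<le> 1)}"
| "ref_corners (Pyramid a) =
     insert (axis a 1) {c. (\<forall>i. c $ i \<in> {0, 1}) \<and> c $ a = 0}"

definition ref_domain :: "'a::finite ref_shape \<Rightarrow> (real ^ 'a) set" where
  "ref_domain s = convex hull (ref_corners s)"

text \<open>
  \<open>shape_fn s c\<close> is the first-order shape function of the corner \<open>c\<close>: products of barycentric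
  coordinates for the product shapes (affine on simplices, multilinear on cubes), and the usual
  rational functions on the pyramid.  Since \<open>x / 0 = 0\<close>, the latter are correct at the apex as well.
\<close>

fun shape_fn :: "'a::finite ref_shape \<Rightarrow> real ^ 'a \<Rightarrow> real ^ 'a \<Rightarrow> real" where
  "shape_fn (Product P) c \<xi> =
     (\<Prod>B\<in>P. if \<forall>i\<in>B. c $ i = 0 then 1 - (\<Sum>i\<in>B. \<xi> $ i) else (\<Sum>i\<in>B. c $ i * \<xi> $ i))"
| "shape_fn (Pyramid a) c \<xi> =
     (if c = axis a 1 then \<xi> $ a
      else (1 - \<xi> $ a) *
        (\<Prod>i\<in>UNIV - {a}. if c $ i = 1 then \<xi> $ i / (1 - \<xi> $ a) else 1 - \<xi> $ i / (1 - \<xi> $ a)))"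

text \<open>
  An element (a cell if \<open>'a\<close> is \<open>'k option\<close>, a face if \<open>'a\<close> is \<open>'k\<close>) is a reference shape
  together with the assignment of grid vertices to its corners; \<open>vert\<close> is irrelevant off the corners.
\<close>

record ('a::finite, 'v) element =
  shape :: "'a ref_shape"
  vert :: "real ^ 'a \<Rightarrow> 'v"

definition elem_verts :: "('a::finite, 'v) element \<Rightarrow> 'v set" where
  "elem_verts e = vert e ` ref_corners (shape e)"

definition elem_map :: "('v \<Rightarrow> 'b::real_vector) \<Rightarrow> ('a::finite, 'v) element \<Rightarrow> real ^ 'a \<Rightarrow> 'b" where
  "elem_map w e \<xi> = (\<Sum>c\<in>ref_corners (shape e). shape_fn (shape e) c \<xi> *\<^sub>R w (vert e c))"

definition local_basis :: "('a::finite, 'v) element \<Rightarrow> 'v \<Rightarrow> real ^ 'a \<Rightarrow> real" where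
  "local_basis e p \<xi> = (\<Sum>c | c \<in> ref_corners (shape e) \<and> vert e c = p. shape_fn (shape e) c \<xi>)"

section \<open>Grids\<close>

text \<open>
  The last conjunct is conformity: the nodal basis functions are single-valued on \<open>S\<close>.  It excludes
  hanging nodes, and it implies that the element maps are injective and that different vertices of
  the grid have different positions.
\<close>

definition is_grid ::
  "('v \<Rightarrow> real ^ 'b) \<Rightarrow> ('a::finite, 'v) element set \<Rightarrow> (real ^ 'b::finite) set \<Rightarrow> bool" where
  "is_grid pos E S \<longleftrightarrow>
     finite E \<and>
     (\<forall>e\<in>E. valid_shape (shape e) \<and> inj_on (vert e) (ref_corners (shape e))) \<and>
     (\<Union>e\<in>E. elem_map pos e ` ref_domain (shape e)) = S \<and>
     (\<forall>e\<in>E. \<forall>e'\<in>E. e \<noteq> e' \<longrightarrow>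
        elem_map pos e ` interior (ref_domain (shape e)) \<inter>
        elem_map pos e' ` interior (ref_domain (shape e')) = {}) \<and>
     (\<forall>e\<in>E. \<forall>e'\<in>E. \<forall>\<xi>\<in>ref_domain (shape e). \<forall>\<xi>'\<in>ref_domain (shape e').
        elem_map pos e \<xi> = elem_map pos e' \<xi>' \<longrightarrow>
        (\<forall>p. local_basis e p \<xi> = local_basis e' p \<xi>'))"

definition nodal_basis ::
  "('v \<Rightarrow> real ^ 'b) \<Rightarrow> ('a::finite, 'v) element set \<Rightarrow> 'v \<Rightarrow> real ^ 'b::finite \<Rightarrow> real" where
  "nodal_basis pos E p X =
     (THE y. \<exists>e\<in>E. \<exists>\<xi>\<in>ref_domain (shape e). elem_map pos e \<xi> = X \<and> y = local_basis e p \<xi>)"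

text \<open>
  The generalised cross product of the tangent vectors \<open>t\<^sub>j\<close> of the face \<open>f\<close> with vertex positions
  \<open>w\<close>, i.e. the vector \<open>\<nu>\<close> with \<open>\<nu> \<bullet> a = det (a | t)\<close> for all \<open>a\<close>.  It is normal to the face, and its
  norm is the surface area density.
\<close>

definition face_cross ::
  "('v \<Rightarrow> real ^ 'k option) \<Rightarrow> ('k::finite, 'v) element \<Rightarrow> real ^ 'k \<Rightarrow> real ^ 'k option" where
  "face_cross w f \<xi> =
     (\<chi> i. det (\<chi> r s. case s of None \<Rightarrow> axis i 1 $ r
        | Some j \<Rightarrow> frechet_derivative (elem_map w f) (at \<xi>) (axis j 1) $ r))"

record ('k::finite, 'v) body =
  region :: "(real ^ 'k option) set"
  cells :: "('k option, 'v) element set"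
  contact :: "(real ^ 'k option) set"
  cfaces :: "('k, 'v) element set"

definition body_verts :: "('k::finite, 'v) body \<Rightarrow> 'v set" where
  "body_verts B = (\<Union>e\<in>cells B. elem_verts e)"

text \<open>
  The last two conjuncts: the grid of the contact boundary is the restriction of the grid of the body,
  and the parametrisations of its faces are oriented such that \<open>face_cross\<close> is an outward normal of
  the reference configuration (which can be achieved by renumbering the corners).
\<close>

definition body_grid :: "('v \<Rightarrow> real ^ 'k option) \<Rightarrow> ('k::finite, 'v) body \<Rightarrow> bool" where
  "body_grid pos B \<longleftrightarrow>
     open (region B) \<and> bounded (region B) \<and> region B \<noteq> {} \<and>
     is_grid pos (cells B) (closure (region B)) \<and>
     contact B \<subseteq> frontier (region B) \<and>
     is_grid pos (cfaces B) (contact B) \<and>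
     (\<forall>f\<in>cfaces B. \<forall>\<xi>\<in>ref_domain (shape f). \<forall>p.
        nodal_basis pos (cells B) p (elem_map pos f \<xi>) = local_basis f p \<xi>) \<and>
     (\<forall>f\<in>cfaces B. \<forall>\<xi>\<in>interior (ref_domain (shape f)). \<exists>\<epsilon>>0. \<forall>t. 0 < t \<and> t < \<epsilon> \<longrightarrow>
        elem_map pos f \<xi> - t *\<^sub>R face_cross pos f \<xi> \<in> region B \<and>
        elem_map pos f \<xi> + t *\<^sub>R face_cross pos f \<xi> \<notin> closure (region B))"

section \<open>The two-body contact setting\<close>

record ('k::finite, 'v, 'c1, 'c2) contact_setting =
  vpos :: "'v \<Rightarrow> real ^ 'k option"
  body1 :: "('k, 'v) body"
  body2 :: "('k, 'v) body"
  cvert1 :: "'c1 \<Rightarrow> 'v"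
  cvert2 :: "'c2 \<Rightarrow> 'v"

text \<open>
  The bodies may touch in the reference configuration, so vertices of different bodies may have the
  same position.
\<close>

definition two_body_contact :: "('k::finite, 'v, 'c1, 'c2) contact_setting \<Rightarrow> bool" where
  "two_body_contact S \<longleftrightarrow>
     CARD('k option) \<in> {2, 3} \<and>
     body_grid (vpos S) (body1 S) \<and> body_grid (vpos S) (body2 S) \<and>
     region (body1 S) \<inter> region (body2 S) = {} \<and>
     body_verts (body1 S) \<inter> body_verts (body2 S) = {} \<and>
     body_verts (body1 S) \<union> body_verts (body2 S) = UNIV \<and>
     inj (cvert1 S) \<and> range (cvert1 S) = {p \<in> body_verts (body1 S). vpos S p \<in> contact (body1 S)} \<and>
     inj (cvert2 S) \<and> range (cvert2 S) = {p \<in> body_verts (body2 S). vpos S p \<in> contact (body2 S)}"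

definition block :: "real ^ ('v::finite \<times> 'k::finite option) \<Rightarrow> 'v \<Rightarrow> real ^ 'k option" where
  "block u p = (\<chi> i. u $ (p, i))"

text \<open>
  The finite element deformation \<open>\<phi>\<^sub>h = (\<Sum>p. z\<^sub>p \<psi>\<^sub>p)\<close>, taken on one body at a time.
\<close>

definition deformation ::
  "('k::finite, 'v::finite, 'c1, 'c2) contact_setting \<Rightarrow> ('k, 'v) body
     \<Rightarrow> real ^ ('v \<times> 'k option) \<Rightarrow> real ^ 'k option \<Rightarrow> real ^ 'k option" where
  "deformation S B z X = (\<Sum>p\<in>UNIV. nodal_basis (vpos S) (cells B) p X *\<^sub>R block z p)"

definition deformed_contact ::
  "('k::finite, 'v::finite, 'c1, 'c2) contact_setting \<Rightarrow> ('k, 'v) body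
     \<Rightarrow> real ^ ('v \<times> 'k option) \<Rightarrow> (real ^ 'k option) set" where
  "deformed_contact S B z = deformation S B z ` contact B"

text \<open>
  The closest-point projection \<open>\<Phi>\<close>; where the closest point is not unique, one is chosen.
\<close>

definition contact_proj ::
  "('k::finite, 'v::finite, 'c1, 'c2) contact_setting
     \<Rightarrow> real ^ ('v \<times> 'k option) \<Rightarrow> real ^ 'k option \<Rightarrow> real ^ 'k option" where
  "contact_proj S z s = closest_point (deformed_contact S (body2 S) z) s"

definition vertex_normal ::
  "('k::finite, 'v::finite, 'c1, 'c2) contact_setting
     \<Rightarrow> real ^ ('v \<times> 'k option) \<Rightarrow> 'v \<Rightarrow> real ^ 'k option" where
  "vertex_normal S z p =
     sgn (\<Sum>f | f \<in> cfaces (body2 S) \<and> p \<in> elem_verts f.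
            sgn (face_cross (block z) f (the_inv_into (ref_corners (shape f)) (vert f) p)))"

text \<open>
  The nodal basis functions of the deformed boundary \<open>\<gamma>\<^sub>h\<^sup>2\<close> are those of the reference grid,
  transported by the deformation.
\<close>

definition normal_field ::
  "('k::finite, 'v::finite, 'c1, 'c2::finite) contact_setting
     \<Rightarrow> real ^ ('v \<times> 'k option) \<Rightarrow> real ^ 'k option \<Rightarrow> real ^ 'k option" where
  "normal_field S z r =
     (\<Sum>q\<in>UNIV. nodal_basis (vpos S) (cells (body2 S)) (cvert2 S q)
                (inv_into (contact (body2 S)) (deformation S (body2 S) z) r)
              *\<^sub>R vertex_normal S z (cvert2 S q))"

definition gap ::
  "('k::finite, 'v::finite, 'c1, 'c2::finite) contact_setting
     \<Rightarrow> real ^ ('v \<times> 'k option) \<Rightarrow> real ^ 'k option \<Rightarrow> real" where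
  "gap S z s = normal_field S z (contact_proj S z s) \<bullet> (s - contact_proj S z s)"

text \<open>
  The surface integral over the face \<open>f\<close> with vertex positions \<open>w\<close> of a function that is given on the
  parameter domain of \<open>f\<close>.
\<close>

definition face_integral ::
  "('v \<Rightarrow> real ^ 'k option) \<Rightarrow> ('k::finite, 'v) element \<Rightarrow> (real ^ 'k \<Rightarrow> real) \<Rightarrow> real" where
  "face_integral w f h = (LINT \<xi>:ref_domain (shape f)|lebesgue. h \<xi> * norm (face_cross w f \<xi>))"

text \<open>
  The dual mortar basis function \<open>\<theta>\<^sub>p\<close> is, on each deformed face, the linear combination of the nodal
  basis functions of that face that is determined by the elementwise biorthogonality
  \<open>\<integral> \<theta>\<^sub>p \<psi>\<^sub>r = \<delta>\<^sub>p\<^sub>r \<integral> \<psi>\<^sub>r\<close>.  In general it is discontinuous across faces, so it is a function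
  of a face and a parameter value.
\<close>

definition dual_coeff ::
  "('v \<Rightarrow> real ^ 'k option) \<Rightarrow> ('k::finite, 'v) element \<Rightarrow> 'v \<Rightarrow> 'v \<Rightarrow> real" where
  "dual_coeff w f p =
     (SOME a. \<forall>r\<in>elem_verts f.
        face_integral w f (\<lambda>\<xi>. (\<Sum>s\<in>elem_verts f. a s * local_basis f s \<xi>) * local_basis f r \<xi>)
          = (if r = p then face_integral w f (local_basis f r) else 0))"

definition dual_basis ::
  "('v \<Rightarrow> real ^ 'k option) \<Rightarrow> ('k::finite, 'v) element \<Rightarrow> 'v \<Rightarrow> real ^ 'k \<Rightarrow> real" where
  "dual_basis w f p \<xi> =
     (if p \<in> elem_verts f then (\<Sum>s\<in>elem_verts f. dual_coeff w f p s * local_basis f s \<xi>) else 0)"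

text \<open>
  On a face \<open>f\<close> of the contact boundary, \<open>elem_map (block z) f\<close> is the deformation composed with the
  reference parametrisation \<open>elem_map (vpos S) f\<close>.
\<close>

definition contact_constraint ::
  "('k::finite, 'v::finite, 'c1::finite, 'c2::finite) contact_setting
     \<Rightarrow> real ^ ('v \<times> 'k option) \<Rightarrow> real ^ 'c1" where
  "contact_constraint S z =
     (\<chi> q. \<Sum>f\<in>cfaces (body1 S). face_integral (block z) f
        (\<lambda>\<xi>. gap S z (elem_map (block z) f \<xi>) * dual_basis (block z) f (cvert1 S q) \<xi>))"

section \<open>Linearisation and decoupling transformation\<close>

definition nonmortar_part ::
  "('k::finite, 'v::finite, 'c1::finite, 'c2) contact_setting
     \<Rightarrow> real ^ ('v \<times> 'k option) \<Rightarrow> real ^ ('c1 \<times> 'k option)" where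
  "nonmortar_part S u = (\<chi> b. u $ (cvert1 S (fst b), snd b))"

definition mortar_part ::
  "('k::finite, 'v::finite, 'c1, 'c2::finite) contact_setting
     \<Rightarrow> real ^ ('v \<times> 'k option) \<Rightarrow> real ^ ('c2 \<times> 'k option)" where
  "mortar_part S u = (\<chi> b. u $ (cvert2 S (fst b), snd b))"

definition first_entries :: "real ^ ('c::finite \<times> 'k::finite option) \<Rightarrow> real ^ 'c" where
  "first_entries u = (\<chi> q. u $ (q, None))"

definition D_mat ::
  "('k::finite, 'v::finite, 'c1::finite, 'c2::finite) contact_setting
     \<Rightarrow> real ^ ('v \<times> 'k option) \<Rightarrow> real ^ ('c1 \<times> 'k option) ^ 'c1" where
  "D_mat S z = (\<chi> q b. jacobian (contact_constraint S) (at z) $ q $ (cvert1 S (fst b), snd b))"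

definition M_mat ::
  "('k::finite, 'v::finite, 'c1::finite, 'c2::finite) contact_setting
     \<Rightarrow> real ^ ('v \<times> 'k option) \<Rightarrow> real ^ ('c2 \<times> 'k option) ^ 'c1" where
  "M_mat S z = (\<chi> q b. jacobian (contact_constraint S) (at z) $ q $ (cvert2 S (fst b), snd b))"

text \<open>
  The Householder reflection \<open>I - 2 v v\<^sup>T / (v\<^sup>T v)\<close> with \<open>v = e\<^sub>1 - n / \<parallel>n\<parallel>\<close>, which maps \<open>e\<^sub>1\<close> to
  \<open>n / \<parallel>n\<parallel>\<close>.  Since \<open>x / 0 = 0\<close>, it is the identity if \<open>n\<close> already has the direction \<open>e\<^sub>1\<close>.
  In the degenerate case \<open>n = 0\<close> we have \<open>sgn n = 0\<close>, and it is the reflection along \<open>e\<^sub>1\<close>.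
\<close>

definition householder :: "real ^ 'k::finite option \<Rightarrow> real ^ 'k option ^ 'k option" where
  "householder n = (let v = axis None 1 - sgn n
     in (\<chi> i j. (if i = j then 1 else 0) - 2 * v $ i * v $ j / (v \<bullet> v)))"

definition O_mat ::
  "('k::finite, 'v::finite, 'c1::finite, 'c2::finite) contact_setting
     \<Rightarrow> real ^ ('v \<times> 'k option) \<Rightarrow> real ^ ('c1 \<times> 'k option) ^ ('c1 \<times> 'k option)" where
  "O_mat S z = (\<chi> a b. case (a, b) of ((p, i), (q, j)) \<Rightarrow>
     if p = q
     then householder (normal_field S z (contact_proj S z (block z (cvert1 S p)))) $ i $ j
     else 0)"

definition DN_mat ::
  "('k::finite, 'v::finite, 'c1::finite, 'c2::finite) contact_setting
     \<Rightarrow> real ^ ('v \<times> 'k option) \<Rightarrow> real ^ 'c1 ^ 'c1" where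
  "DN_mat S z = (\<chi> p q. (D_mat S z ** O_mat S z) $ p $ (q, None))"

definition DT_mat ::
  "('k::finite, 'v::finite, 'c1::finite, 'c2::finite) contact_setting
     \<Rightarrow> real ^ ('v \<times> 'k option) \<Rightarrow> real ^ ('c1 \<times> 'k) ^ 'c1" where
  "DT_mat S z = (\<chi> p b. (D_mat S z ** O_mat S z) $ p $ (fst b, Some (snd b)))"

definition K_mat ::
  "('k::finite, 'v::finite, 'c1::finite, 'c2::finite) contact_setting
     \<Rightarrow> real ^ ('v \<times> 'k option) \<Rightarrow> real ^ ('c1 \<times> 'k option) ^ ('c1 \<times> 'k option)" where
  "K_mat S z = (\<chi> a b. case (a, b) of
      ((p, None), (q, None)) \<Rightarrow> - (matrix_inv (DN_mat S z) $ p $ q)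
    | ((p, None), (q, Some j)) \<Rightarrow> - ((matrix_inv (DN_mat S z) ** DT_mat S z) $ p $ (q, j))
    | ((p, Some i), (q, None)) \<Rightarrow> 0
    | ((p, Some i), (q, Some j)) \<Rightarrow> if p = q \<and> i = j then 1 else 0)"

definition L_mat ::
  "('k::finite, 'v::finite, 'c1::finite, 'c2::finite) contact_setting
     \<Rightarrow> real ^ ('v \<times> 'k option) \<Rightarrow> real ^ ('c2 \<times> 'k option) ^ ('c1 \<times> 'k option)" where
  "L_mat S z = (\<chi> a b. case a of
      (p, None) \<Rightarrow> (matrix_inv (DN_mat S z) ** M_mat S z) $ p $ b
    | (p, Some i) \<Rightarrow> 0)"

text \<open>
  The block rows and columns of \<open>T\<close> belong to the vertices in the range of \<open>cvert1\<close>, to those in the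
  range of \<open>cvert2\<close>, and to all others.
\<close>

definition T_mat ::
  "('k::finite, 'v::finite, 'c1::finite, 'c2::finite) contact_setting
     \<Rightarrow> real ^ ('v \<times> 'k option) \<Rightarrow> real ^ ('v \<times> 'k option) ^ ('v \<times> 'k option)" where
  "T_mat S z = (\<chi> a b. case (a, b) of ((p, i), (q, j)) \<Rightarrow>
     if p \<in> range (cvert1 S) then
       if q \<in> range (cvert1 S) then
         (O_mat S z ** K_mat S z) $ (inv (cvert1 S) p, i) $ (inv (cvert1 S) q, j)
       else if q \<in> range (cvert2 S) then
         - ((O_mat S z ** L_mat S z) $ (inv (cvert1 S) p, i) $ (inv (cvert2 S) q, j))
       else 0
     else if p = q \<and> i = j then 1 else 0)"

end

theory Submission
  imports Defs
begin

text \<open>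
  Write \<open>u = T w\<close>, so that \<open>w = T\<^sup>-\<^sup>1 u\<close>, and let \<open>x\<close>, \<open>y\<close> be the non-mortar and mortar parts of
  \<open>w\<close>.  Then \<open>u\<close> has the non-mortar part \<open>O (K x - L y)\<close> and the mortar part \<open>y\<close>.  Splitting \<open>x\<close>
  into first entries \<open>x\<^sub>N\<close> and remaining entries \<open>x\<^sub>T\<close>, the vector \<open>K x - L y\<close> has the first entries
  \<open>- D\<^sub>N\<^sup>-\<^sup>1 (x\<^sub>N + D\<^sub>T x\<^sub>T + M y)\<close> and the remaining entries \<open>x\<^sub>T\<close>.  In words: \<open>K\<close> and \<open>L\<close>
  solve the equation \<open>D\<^sub>N v\<^sub>N + D\<^sub>T v\<^sub>T + M y = - x\<^sub>N\<close> for the normal displacements \<open>v\<^sub>N\<close>, given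
  \<open>v\<^sub>T = x\<^sub>T\<close>.  Since \<open>D O\<close> acts as \<open>v \<mapsto> D\<^sub>N v\<^sub>N + D\<^sub>T v\<^sub>T\<close>, the left-hand side of the linearised
  constraints is exactly \<open>- x\<^sub>N\<close> (lemma \<open>linearised_constraint_T_mat\<close>), and negating both sides
  gives the claim.

  The transformation \<open>T\<close> is invertible because it is injective: if \<open>T w = 0\<close>, then \<open>w\<close> vanishes at
  all vertices off the non-mortar boundary, so \<open>O K x = 0\<close>.  The matrix \<open>O\<close> is an involution, being
  built from reflections, and \<open>K x = 0\<close> first gives \<open>x\<^sub>T = 0\<close> and then \<open>D\<^sub>N\<^sup>-\<^sup>1 x\<^sub>N = 0\<close>, so
  \<open>x = 0\<close>.

  The block form of \<open>T\<close> rests on the geometry of the grids: the two contact boundaries have no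
  vertex in common, and their vertices are numbered injectively.
\<close>

lemma matrix_vector_minus_right:
  fixes A :: "real ^ 'n::finite ^ 'm::finite"
  shows "A *v (- x) = - (A *v x)"
  by (simp add: linear_neg)

lemma matrix_inv_right:
  fixes A :: "real ^ 'n::finite ^ 'n"
  assumes "invertible A"
  shows "A ** matrix_inv A = mat 1"
  using someI_ex[OF assms[unfolded invertible_def]] by (simp add: matrix_inv_def)

section \<open>First and remaining entries of block vectors\<close>

definition remaining_entries :: "real ^ ('c::finite \<times> 'k::finite option) \<Rightarrow> real ^ ('c \<times> 'k)" where
  "remaining_entries x = (\<chi> b. x $ (fst b, Some (snd b)))"

lemma sum_option_blocks:
  fixes f :: "'c::finite \<times> 'k::finite option \<Rightarrow> real"
  shows "(\<Sum>b\<in>UNIV. f b) = (\<Sum>q\<in>UNIV. f (q, None)) + (\<Sum>b\<in>UNIV. f (fst b, Some (snd b)))"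
proof -
  have "(\<Sum>b\<in>UNIV. f b) = (\<Sum>q\<in>UNIV. \<Sum>j\<in>UNIV. f (q, j))"
    by (simp add: sum.cartesian_product)
  also have "\<dots> = (\<Sum>q\<in>UNIV. f (q, None) + (\<Sum>j\<in>UNIV. f (q, Some j)))"
    by (simp add: UNIV_option_conv sum.reindex)
  also have "\<dots> = (\<Sum>q\<in>UNIV. f (q, None)) + (\<Sum>q\<in>UNIV. \<Sum>j\<in>UNIV. f (q, Some j))"
    by (simp add: sum.distrib)
  also have "(\<Sum>q\<in>UNIV. \<Sum>j\<in>UNIV. f (q, Some j)) = (\<Sum>b\<in>UNIV. f (fst b, Some (snd b)))"
    by (simp add: sum.cartesian_product case_prod_unfold)
  finally show ?thesis .
qed

lemma vec_eq_iff_entries: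
  fixes x y :: "real ^ ('c::finite \<times> 'k::finite option)"
  shows "x = y \<longleftrightarrow> first_entries x = first_entries y \<and> remaining_entries x = remaining_entries y"
proof
  assume entries: "first_entries x = first_entries y \<and> remaining_entries x = remaining_entries y"
  have "x $ (p, i) = y $ (p, i)" for p i
    using entries by (cases i) (auto simp: first_entries_def remaining_entries_def vec_eq_iff)
  then show "x = y"
    by (simp add: vec_eq_iff split_paired_all)
qed simp

lemma entries_diff:
  "first_entries (x - y) = first_entries x - first_entries y"
  "remaining_entries (x - y) = remaining_entries x - remaining_entries y"
  by (simp_all add: first_entries_def remaining_entries_def vec_eq_iff)

section \<open>The Householder reflections\<close>

text \<open>
  Because \<open>x / 0 = 0\<close>, this includes the case \<open>v = 0\<close>, where the reflection is the identity.
\<close>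

lemma householder_involution:
  fixes n :: "real ^ 'k::finite option"
  shows "householder n ** householder n = mat 1"
proof -
  define v where "v = axis None 1 - sgn n"
  define \<beta> where "\<beta> = 2 / (v \<bullet> v)"
  have H: "householder n $ i $ j = (if i = j then 1 else 0) - \<beta> * (v $ i * v $ j)" for i j
    by (simp add: householder_def v_def \<beta>_def Let_def)
  \<comment> \<open>The normalisation of the reflection, which makes the quadratic term cancel the linear ones.\<close>
  have beta: "\<beta> * \<beta> * (v \<bullet> v) = 2 * \<beta>"
    by (simp add: \<beta>_def)
  have "(householder n ** householder n) $ i $ j = (mat 1 :: real ^ 'k option ^ 'k option) $ i $ j"
    for i j
  proof -
    have "(householder n ** householder n) $ i $ j
        = (\<Sum>l\<in>UNIV. (if i = l then (if l = j then 1 else 0) - \<beta> * (v $ l * v $ j) else 0)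
             - (if j = l then \<beta> * (v $ i * v $ l) else 0)
             + \<beta> * \<beta> * v $ i * v $ j * (v $ l * v $ l))"
      unfolding matrix_matrix_mult_def vec_lambda_beta H
      by (rule sum.cong) (auto simp: algebra_simps)
    also have "\<dots> = (if i = j then 1 else 0) - 2 * \<beta> * (v $ i * v $ j)
                    + \<beta> * \<beta> * v $ i * v $ j * (v \<bullet> v)"
      by (simp add: sum.distrib sum_subtractf inner_vec_def
          flip: sum_distrib_left)
    also have "\<beta> * \<beta> * v $ i * v $ j * (v \<bullet> v) = (\<beta> * \<beta> * (v \<bullet> v)) * (v $ i * v $ j)"
      by (simp add: mult_ac)
    also have "\<dots> = 2 * \<beta> * (v $ i * v $ j)"
      unfolding beta ..
    finally show ?thesis
      by (simp add: mat_def)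
  qed
  then show ?thesis
    by (simp add: vec_eq_iff)
qed

lemma O_mat_involution:
  fixes S :: "('k::finite, 'v::finite, 'c1::finite, 'c2::finite) contact_setting"
  shows "O_mat S z ** O_mat S z = mat 1"
proof -
  define H where
    "H p = householder (normal_field S z (contact_proj S z (block z (cvert1 S p))))" for p
  have O_entry: "O_mat S z $ (p, i) $ (q, j) = (if p = q then H p $ i $ j else 0)" for p i q j
    by (simp add: O_mat_def H_def)
  have H_entry: "(\<Sum>l\<in>UNIV. H p $ i $ l * H p $ l $ j) = (if i = j then 1 else 0)" for p i j
    using householder_involution[of "normal_field S z (contact_proj S z (block z (cvert1 S p)))"]
    by (simp add: H_def vec_eq_iff matrix_matrix_mult_def mat_def)
  have "(O_mat S z ** O_mat S z) $ (p, i) $ (q, j)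
      = (mat 1 :: real ^ ('c1 \<times> 'k option) ^ ('c1 \<times> 'k option)) $ (p, i) $ (q, j)" for p i q j
  proof -
    have "(O_mat S z ** O_mat S z) $ (p, i) $ (q, j)
        = (\<Sum>r\<in>UNIV. \<Sum>l\<in>UNIV. O_mat S z $ (p, i) $ (r, l) * O_mat S z $ (r, l) $ (q, j))"
      by (simp add: matrix_matrix_mult_def sum.cartesian_product)
    also have "\<dots> = (\<Sum>r\<in>UNIV. if p = r
        then (if r = q then \<Sum>l\<in>UNIV. H r $ i $ l * H r $ l $ j else 0) else 0)"
      by (rule sum.cong) (auto simp: O_entry)
    also have "\<dots> = (if p = q \<and> i = j then 1 else 0)"
      by (simp add: H_entry)
    finally show ?thesis
      by (simp add: mat_def)
  qed
  then show ?thesis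
    by (simp add: vec_eq_iff split_paired_all)
qed

section \<open>Action of the transformation on the contact boundaries\<close>

lemma D_mat_O_mat_mult:
  "(D_mat S z ** O_mat S z) *v x = DN_mat S z *v first_entries x + DT_mat S z *v remaining_entries x"
  by (simp add: vec_eq_iff matrix_vector_mult_def sum_option_blocks DN_mat_def DT_mat_def
      first_entries_def remaining_entries_def)

lemma K_mat_entries:
  "first_entries (K_mat S z *v x)
     = - (matrix_inv (DN_mat S z) *v (first_entries x + DT_mat S z *v remaining_entries x))"
  "remaining_entries (K_mat S z *v x) = remaining_entries x"
proof -
  have "first_entries (K_mat S z *v x)
      = - (matrix_inv (DN_mat S z) *v first_entries x)
        - (matrix_inv (DN_mat S z) ** DT_mat S z) *v remaining_entries x"
    by (simp add: vec_eq_iff matrix_vector_mult_def sum_option_blocks K_mat_def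
        first_entries_def remaining_entries_def sum_negf)
  then show "first_entries (K_mat S z *v x)
     = - (matrix_inv (DN_mat S z) *v (first_entries x + DT_mat S z *v remaining_entries x))"
    by (simp add: matrix_vector_right_distrib matrix_vector_mul_assoc)
  have "(K_mat S z *v x) $ (p, Some i) = x $ (p, Some i)" for p i
  proof -
    have row: "K_mat S z $ (p, Some i) $ (q, None) = 0"
      "K_mat S z $ (p, Some i) $ (fst b, Some (snd b)) = (if (p, i) = b then 1 else 0)" for q b
      by (auto simp: K_mat_def)
    have "(K_mat S z *v x) $ (p, Some i)
        = (\<Sum>b\<in>UNIV. if (p, i) = b then x $ (fst b, Some (snd b)) else 0)"
      unfolding matrix_vector_mult_def vec_lambda_beta sum_option_blocks row
      by (simp add: if_distrib[of "\<lambda>a. a * _"] cong: if_cong)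
    then show ?thesis
      by simp
  qed
  then show "remaining_entries (K_mat S z *v x) = remaining_entries x"
    by (simp add: vec_eq_iff remaining_entries_def)
qed

lemma L_mat_entries:
  "first_entries (L_mat S z *v y) = matrix_inv (DN_mat S z) *v (M_mat S z *v y)"
  "remaining_entries (L_mat S z *v y) = 0"
proof -
  have "first_entries (L_mat S z *v y) = (matrix_inv (DN_mat S z) ** M_mat S z) *v y"
    by (simp add: vec_eq_iff matrix_vector_mult_def L_mat_def first_entries_def)
  then show "first_entries (L_mat S z *v y) = matrix_inv (DN_mat S z) *v (M_mat S z *v y)"
    by (simp add: matrix_vector_mul_assoc)
  show "remaining_entries (L_mat S z *v y) = 0"
    by (simp add: vec_eq_iff matrix_vector_mult_def L_mat_def remaining_entries_def)
qed

lemma contact_vertices: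
  assumes "two_body_contact S"
  shows "inj (cvert1 S)" and "inj (cvert2 S)" and "range (cvert1 S) \<inter> range (cvert2 S) = {}"
proof -
  have disj: "body_verts (body1 S) \<inter> body_verts (body2 S) = {}"
    and ranges: "range (cvert1 S) = {p \<in> body_verts (body1 S). vpos S p \<in> contact (body1 S)}"
      "range (cvert2 S) = {p \<in> body_verts (body2 S). vpos S p \<in> contact (body2 S)}"
    using assms by (auto simp only: two_body_contact_def)
  show "range (cvert1 S) \<inter> range (cvert2 S) = {}"
    unfolding ranges using disj by blast
  show "inj (cvert1 S)" "inj (cvert2 S)"
    using assms by (auto simp only: two_body_contact_def)
qed

text \<open>
  The rows of \<open>T\<close> are indexed by all grid vertices and reach into the blocks \<open>K\<close>, \<open>L\<close>, which are
  indexed by contact vertices, through the inverse numbering.  Passing to the contact vertices turns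
  a row of \<open>T w\<close> into rows of matrix products with the contact parts of \<open>w\<close>.
\<close>

lemma sum_over_numbered_blocks:
  fixes c :: "'c::finite \<Rightarrow> 'v::finite" and g :: "'c \<times> 'i::finite \<Rightarrow> real"
    and w :: "real ^ ('v \<times> 'i)"
  assumes "inj c"
  shows "(\<Sum>(q, j)\<in>UNIV. if q \<in> range c then g (inv c q, j) * w $ (q, j) else 0)
       = (\<Sum>b\<in>UNIV. g b * w $ (c (fst b), snd b))"
proof -
  have "(\<Sum>(q, j)\<in>UNIV. if q \<in> range c then g (inv c q, j) * w $ (q, j) else 0)
      = (\<Sum>q\<in>UNIV. if q \<in> range c then \<Sum>j\<in>UNIV. g (inv c q, j) * w $ (q, j) else 0)"
    unfolding UNIV_Times_UNIV[symmetric] sum.cartesian_product[symmetric]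
    by (rule sum.cong) auto
  also have "\<dots> = (\<Sum>q\<in>range c. \<Sum>j\<in>UNIV. g (inv c q, j) * w $ (q, j))"
    by (rule sum.mono_neutral_cong_right) auto
  also have "\<dots> = (\<Sum>p\<in>UNIV. \<Sum>j\<in>UNIV. g (p, j) * w $ (c p, j))"
    using assms by (simp add: sum.reindex)
  also have "\<dots> = (\<Sum>b\<in>UNIV. g b * w $ (c (fst b), snd b))"
    by (simp add: sum.cartesian_product case_prod_unfold)
  finally show ?thesis .
qed

lemma nonmortar_part_T_mat:
  assumes "two_body_contact S"
  shows "nonmortar_part S (T_mat S z *v w)
       = O_mat S z *v (K_mat S z *v nonmortar_part S w - L_mat S z *v mortar_part S w)"
proof -
  note inj = contact_vertices(1,2)[OF assms] and disj = contact_vertices(3)[OF assms]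
  have not_both: False if "cvert1 S q = cvert2 S r" for q r
    using disj that by (metis IntI empty_iff rangeI)
  let ?OK = "O_mat S z ** K_mat S z" and ?OL = "O_mat S z ** L_mat S z"
  have "nonmortar_part S (T_mat S z *v w) $ (p, i)
      = (?OK *v nonmortar_part S w - ?OL *v mortar_part S w) $ (p, i)" for p i
  proof -
    have "nonmortar_part S (T_mat S z *v w) $ (p, i)
        = (\<Sum>(q, j)\<in>UNIV. (if q \<in> range (cvert1 S)
              then ?OK $ (p, i) $ (inv (cvert1 S) q, j) * w $ (q, j) else 0)
            - (if q \<in> range (cvert2 S)
              then ?OL $ (p, i) $ (inv (cvert2 S) q, j) * w $ (q, j) else 0))"
      unfolding nonmortar_part_def matrix_vector_mult_def vec_lambda_beta T_mat_def
      using inj by (intro sum.cong) (auto simp: inv_f_f dest: not_both)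
    also have "\<dots> = (\<Sum>b\<in>UNIV. ?OK $ (p, i) $ b * w $ (cvert1 S (fst b), snd b))
                  - (\<Sum>b\<in>UNIV. ?OL $ (p, i) $ b * w $ (cvert2 S (fst b), snd b))"
      using sum_over_numbered_blocks[OF inj(1), of "\<lambda>b. ?OK $ (p, i) $ b" w]
        sum_over_numbered_blocks[OF inj(2), of "\<lambda>b. ?OL $ (p, i) $ b" w]
      by (simp add: case_prod_unfold sum_subtractf)
    also have "\<dots> = (?OK *v nonmortar_part S w - ?OL *v mortar_part S w) $ (p, i)"
      by (simp add: matrix_vector_mult_def nonmortar_part_def mortar_part_def)
    finally show ?thesis .
  qed
  then have "nonmortar_part S (T_mat S z *v w)
      = ?OK *v nonmortar_part S w - ?OL *v mortar_part S w"
    by (simp add: vec_eq_iff split_paired_all)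
  then show ?thesis
    by (simp add: matrix_vector_mult_diff_distrib matrix_vector_mul_assoc)
qed

lemma T_mat_off_nonmortar:
  assumes "p \<notin> range (cvert1 S)"
  shows "(T_mat S z *v w) $ (p, i) = w $ (p, i)"
proof -
  have "(T_mat S z *v w) $ (p, i) = (\<Sum>b\<in>UNIV. if (p, i) = b then w $ b else 0)"
    unfolding matrix_vector_mult_def vec_lambda_beta T_mat_def
    using assms by (intro sum.cong) (auto split: prod.split)
  then show ?thesis
    by simp
qed

lemma mortar_part_T_mat:
  assumes "two_body_contact S"
  shows "mortar_part S (T_mat S z *v w) = mortar_part S w"
proof -
  have "cvert2 S q \<notin> range (cvert1 S)" for q
    using contact_vertices(3)[OF assms] by blast
  then show ?thesis
    by (simp add: vec_eq_iff mortar_part_def T_mat_off_nonmortar)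
qed

section \<open>The linearised constraints in transformed coordinates\<close>

text \<open>
  The tangential contributions \<open>D\<^sub>T x\<^sub>T\<close> and the mortar contributions \<open>M y\<close> are cancelled by the
  terms that \<open>K\<close> and \<open>L\<close> add to the normal displacement.
\<close>

lemma linearised_constraint_T_mat:
  assumes "two_body_contact S" and "invertible (DN_mat S z)"
  shows "D_mat S z *v nonmortar_part S (T_mat S z *v w) + M_mat S z *v mortar_part S (T_mat S z *v w)
       = - first_entries (nonmortar_part S w)"
proof -
  let ?x = "nonmortar_part S w" and ?y = "mortar_part S w"
  let ?v = "K_mat S z *v ?x - L_mat S z *v ?y"
  have cancel: "DN_mat S z *v (matrix_inv (DN_mat S z) *v a) = a" for a
    by (simp add: matrix_vector_mul_assoc matrix_inv_right[OF assms(2)])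
  have "D_mat S z *v nonmortar_part S (T_mat S z *v w) = (D_mat S z ** O_mat S z) *v ?v"
    by (simp add: nonmortar_part_T_mat[OF assms(1)] matrix_vector_mul_assoc)
  also have "\<dots> = - first_entries ?x - M_mat S z *v ?y"
    by (simp add: D_mat_O_mat_mult entries_diff K_mat_entries L_mat_entries
        matrix_vector_mult_diff_distrib matrix_vector_minus_right cancel)
  finally show ?thesis
    by (simp add: mortar_part_T_mat[OF assms(1)])
qed

lemma T_mat_kernel:
  assumes "two_body_contact S" and "invertible (DN_mat S z)" and "T_mat S z *v w = 0"
  shows "w = 0"
proof -
  let ?x = "nonmortar_part S w"
  have off: "w $ (p, i) = 0" if "p \<notin> range (cvert1 S)" for p i
    using T_mat_off_nonmortar[OF that, of z w i] assms(3) by simp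
  have "mortar_part S w = mortar_part S (T_mat S z *v w)"
    by (simp add: mortar_part_T_mat[OF assms(1)])
  then have y: "mortar_part S w = 0"
    by (simp add: assms(3) mortar_part_def vec_eq_iff)
  have "O_mat S z *v (K_mat S z *v ?x) = nonmortar_part S (T_mat S z *v w)"
    by (simp add: nonmortar_part_T_mat[OF assms(1)] y)
  also have "\<dots> = 0"
    by (simp add: assms(3) nonmortar_part_def vec_eq_iff)
  finally have "O_mat S z *v (O_mat S z *v (K_mat S z *v ?x)) = 0"
    by simp
  then have "K_mat S z *v ?x = 0"
    by (simp only: matrix_vector_mul_assoc[of "O_mat S z" "O_mat S z"] O_mat_involution
        matrix_vector_mul_lid)
  then have K: "first_entries (K_mat S z *v ?x) = 0" "remaining_entries (K_mat S z *v ?x) = 0"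
    by (simp_all add: first_entries_def remaining_entries_def vec_eq_iff)
  have xT: "remaining_entries ?x = 0"
    using K(2) by (simp add: K_mat_entries)
  with K(1) have "matrix_inv (DN_mat S z) *v first_entries ?x = 0"
    by (simp add: K_mat_entries)
  then have "DN_mat S z *v (matrix_inv (DN_mat S z) *v first_entries ?x) = 0"
    by simp
  then have xN: "first_entries ?x = 0"
    by (simp add: matrix_vector_mul_assoc matrix_inv_right[OF assms(2)])
  have "?x = 0"
    using xN xT by (simp add: vec_eq_iff_entries first_entries_def remaining_entries_def vec_eq_iff)
  then have "w $ (cvert1 S q, i) = 0" for q i
    by (simp add: nonmortar_part_def vec_eq_iff)
  with off have "w $ (p, i) = 0" for p i
    by (cases "p \<in> range (cvert1 S)") auto
  then show ?thesis
    by (simp add: vec_eq_iff split_paired_all)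
qed

lemma invertible_T_mat:
  assumes "two_body_contact S" and "invertible (DN_mat S z)"
  shows "invertible (T_mat S z)"
  using T_mat_kernel[OF assms] by (auto simp: invertible_left_inverse matrix_left_invertible_ker)

theorem lemma4p3:
  fixes S :: "('k::finite, 'v::finite, 'c1::finite, 'c2::finite) contact_setting"
    and z :: "real ^ ('v \<times> 'k option)"
  assumes "two_body_contact S"
    and "contact_constraint S differentiable (at z)"
    and "invertible (DN_mat S z)"
  shows "invertible (T_mat S z) \<and>
    (\<forall>u :: real ^ ('v \<times> 'k option).
       D_mat S z *v nonmortar_part S u + M_mat S z *v mortar_part S u \<ge> - contact_constraint S z
       \<longleftrightarrow> first_entries (nonmortar_part S (matrix_inv (T_mat S z) *v u)) \<le> contact_constraint S z)"
proof (intro conjI allI)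
  show T: "invertible (T_mat S z)"
    by (rule invertible_T_mat[OF assms(1,3)])
  fix u :: "real ^ ('v \<times> 'k option)"
  let ?w = "matrix_inv (T_mat S z) *v u"
  have "T_mat S z *v ?w = u"
    by (simp add: matrix_vector_mul_assoc matrix_inv_right[OF T])
  then have "D_mat S z *v nonmortar_part S u + M_mat S z *v mortar_part S u
      = - first_entries (nonmortar_part S ?w)"
    using linearised_constraint_T_mat[OF assms(1,3), of ?w] by simp
  then show "D_mat S z *v nonmortar_part S u + M_mat S z *v mortar_part S u
        \<ge> - contact_constraint S z
      \<longleftrightarrow> first_entries (nonmortar_part S ?w) \<le> contact_constraint S z"
    by (simp add: less_eq_vec_def)
qed

end
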